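(* Let $d\ge2$ be an integer and let $k=d-1$. Consider the family of linear maps $\Phi_{\alpha,\beta}:M_d\to M_d$, $\Phi_{\alpha,\beta}=(1-\alpha-\beta)\,\mathcal{I}+\alpha\,\tau_0+\beta\,\Delta$, $\alpha,\beta\in\mathbb{R}$. Then the set of all $k$-positive maps in this family forms a quadrilateral, namely $$\operatorname{conv}\{\Psi_0,\Psi_1,\Psi_2,\mathcal{T}_k\}.$$
   Context: $M_d$ is the algebra of $d\times d$ complex matrices. $\mathcal{I}$ is the identity map on $M_d$, $\tau_0(X)=\frac{1}{d}(\operatorname{Tr}X)\,\mathbb{I}_d$, and $\Delta(X)$ is the diagonal part of $X$ (the diagonal matrix with the same diagonal entries as $X$ in the standard basis). The named maps are $\Psi_0=\Phi_{0,0}$, $\Psi_1=\Phi_{0,\frac{d}{d-1}}$, $\Psi_2=\Phi_{\frac{d}{d-1},-\frac{1}{d-1}}$ and $\mathcal{T}_k=\Phi_{\alpha_k,0}$ with $\alpha_k=\frac{kd}{kd-1}$. Here $\operatorname{conv}$ denotes the convex hull (in the real vector space of linear maps, equivalently in the $(\alpha,\beta)$-plane). A linear map $\Phi$ is $k$-positive if $\mathrm{id}_{M_k}\otimes\Phi$ sends positive semidefinite matrices to positive semidefinite matrices.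
   Formalization: The formal theorem takes d ≥ 3 instead of d ≥ 2: for d = 2, k = 1 the claim fails, since Φ_{2,−2} (transposition followed by conjugation with the flip) is positive but lies outside conv{Ψ0, Ψ1, Ψ2, T_1}. *)

theory Defs
  imports "HOL-Analysis.Analysis"
begin

text \<open>
  $M_d$ is \<open>complex^'d^'d\<close> with $d$ = \<open>CARD('d)\<close>.  Linear maps on $M_d$ live in the space
  \<open>'d mat_map\<close> of bounded real-linear maps: it is a real vector space, which is what convex hulls
  and extreme points need, and it contains all complex-linear maps.
\<close>

type_synonym 'd mat_map = "(complex^'d^'d) \<Rightarrow>\<^sub>L (complex^'d^'d)"

lift_definition tau0 :: "'d::finite mat_map"
  is "\<lambda>X. mat (trace X / of_nat CARD('d))"
  by (intro linear_conv_bounded_linear[THEN iffD1] linearI)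
     (auto simp: vec_eq_iff mat_def trace_def sum.distrib add_divide_distrib
       scaleR_sum_right[symmetric], simp add: scaleR_conv_of_real)

lift_definition Delta :: "'d::finite mat_map"
  is "\<lambda>X. \<chi> i j. if i = j then X $ i $ j else 0"
  by (intro linear_conv_bounded_linear[THEN iffD1] linearI) (auto simp: vec_eq_iff)

definition Phi :: "real \<Rightarrow> real \<Rightarrow> 'd::finite mat_map" where
  "Phi \<alpha> \<beta> = (1 - \<alpha> - \<beta>) *\<^sub>R id_blinfun + \<alpha> *\<^sub>R tau0 + \<beta> *\<^sub>R Delta"

definition Psi0 :: "'d::finite mat_map" where
  "Psi0 = Phi 0 0"

definition Psi1 :: "'d::finite mat_map" where
  "Psi1 = Phi 0 (real CARD('d) / (real CARD('d) - 1))"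

definition Psi2 :: "'d::finite mat_map" where
  "Psi2 = Phi (real CARD('d) / (real CARD('d) - 1)) (- 1 / (real CARD('d) - 1))"

definition T_map :: "nat \<Rightarrow> 'd::finite mat_map" where
  "T_map k = Phi (real k * real CARD('d) / (real k * real CARD('d) - 1)) 0"

text \<open>Over \<open>complex\<close>, realness of the quadratic form for all vectors already forces the matrix to
  be Hermitian.\<close>

definition psd :: "complex^'n::finite^'n \<Rightarrow> bool" where
  "psd A \<longleftrightarrow> (\<forall>v. let q = (\<Sum>i\<in>UNIV. cnj (v $ i) * (A *v v) $ i) in q \<in> \<real> \<and> 0 \<le> Re q)"

text \<open>$M_k \otimes M_d$ is identified with the matrices indexed by \<open>'k \<times> 'd\<close>; the \<open>(i, j)\<close> block
  of such a matrix is the coefficient of the matrix unit $E_{ij}$ of $M_k$.\<close>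

definition block :: "complex^('k::finite \<times> 'd::finite)^('k \<times> 'd) \<Rightarrow> 'k \<Rightarrow> 'k \<Rightarrow> complex^'d^'d" where
  "block A i j = (\<chi> a b. A $ (i, a) $ (j, b))"

definition id_tensor ::
  "'d::finite mat_map \<Rightarrow> complex^('k::finite \<times> 'd)^('k \<times> 'd) \<Rightarrow> complex^('k \<times> 'd)^('k \<times> 'd)" where
  "id_tensor \<Phi> A = (\<chi> p q. blinfun_apply \<Phi> (block A (fst p) (fst q)) $ snd p $ snd q)"

text \<open>$k$-positivity, with $k$ = \<open>CARD('k)\<close> passed as a type argument.  A caveat on dimension
  $2$: for $d = 2$ and $k = 1$ the map \<open>Phi 2 (-2)\<close>, which is transposition followed by
  conjugation with the flip, is positive, but it lies outside the hull of \<open>Psi0\<close>, \<open>Psi1\<close>, \<open>Psi2\<close>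
  and \<open>T_map 1\<close>: there $\alpha/d + \beta \ge 0$, which $2$-positivity would force.\<close>

definition k_positive :: "'k::finite itself \<Rightarrow> 'd::finite mat_map \<Rightarrow> bool" where
  "k_positive _ \<Phi> \<longleftrightarrow> (\<forall>A :: complex^('k \<times> 'd)^('k \<times> 'd). psd A \<longrightarrow> psd (id_tensor \<Phi> A))"

text \<open>A non-degenerate planar quadrilateral, with its interior; by the extreme-point condition
  the four corners are in convex position.\<close>

definition quadrilateral :: "'a::real_vector set \<Rightarrow> bool" where
  "quadrilateral S \<longleftrightarrow>
     (\<exists>V. card V = 4 \<and> coplanar V \<and> S = convex hull V \<and> (\<forall>v\<in>V. v extreme_point_of S))"

end

theory Submission
  imports Defs
begin

text \<open>
  Evaluating the quadratic form of \<open>(id \<otimes> \<Phi>) A\<close> at $v = \sum_j v_j \otimes e_j$ turns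
  $k$-positivity of $\Phi_{\alpha,\beta}$ into nonnegativity of
  $(1-\alpha-\beta)\,q(v) + \frac{\alpha}{d}\sum_{i,j} q(v_j \otimes e_i)
   + \beta \sum_j q(v_j \otimes e_j)$ for every positive semidefinite form $q$ on
  $C^k \otimes C^d$.
  At the four corners this follows from the Cauchy--Schwarz inequality for $q$.  For rank-one $q$
  the expression becomes
  $(1-\alpha-\beta)\,|\mathrm{tr}\,G|^2 + \frac{\alpha}{d}\sum_{i,j} |G_{ij}|^2
   + \beta \sum_i |G_{ii}|^2$ with $G$ of rank at most $k$, and the four matrices
  $E_{12}$, $E_{11} - E_{22}$, $\mathrm{diag}(1,\dots,1,0)$, $1 - J/d$ (with $J$ the all-ones matrix)
  give the inequalities of the four edges.
\<close>

section \<open>Sesquilinear forms and the Cauchy-Schwarz inequality\<close>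

definition sesq :: "complex^'n::finite^'n \<Rightarrow> complex^'n \<Rightarrow> complex^'n \<Rightarrow> complex" where
  "sesq A x y = (\<Sum>i\<in>UNIV. \<Sum>j\<in>UNIV. cnj (x $ i) * A $ i $ j * y $ j)"

lemma psd_iff_sesq: "psd A \<longleftrightarrow> (\<forall>v. sesq A v v \<in> \<real> \<and> 0 \<le> Re (sesq A v v))"
proof -
  have "(\<Sum>i\<in>UNIV. cnj (v $ i) * (A *v v) $ i) = sesq A v v" for v
    by (simp add: sesq_def matrix_vector_mult_def sum_distrib_left mult.assoc)
  then show ?thesis by (simp add: psd_def Let_def)
qed

lemma sesq_diff_left: "sesq A (x - y) z = sesq A x z - sesq A y z"
  by (simp add: sesq_def algebra_simps sum_subtractf)

lemma sesq_diff_right: "sesq A z (x - y) = sesq A z x - sesq A z y"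
  by (simp add: sesq_def algebra_simps sum_subtractf)

lemma sesq_smult: "sesq A (c *s x) (e *s y) = cnj c * e * sesq A x y"
  by (simp add: sesq_def sum_distrib_left mult.assoc mult.left_commute)

lemma sesq_sum_left: "sesq A (\<Sum>s\<in>S. x s) y = (\<Sum>s\<in>S. sesq A (x s) y)"
  by (simp add: sesq_def sum_distrib_right sum.swap[where A = S])

lemma sesq_sum_right: "sesq A y (\<Sum>s\<in>S. x s) = (\<Sum>s\<in>S. sesq A y (x s))"
  by (simp add: sesq_def sum_distrib_left sum.swap[where A = S])

text \<open>Lagrange's identity: the difference of the two sides is half the sum over \<open>s, t\<close> of the
  form at \<open>cnj (m t) *s x s - cnj (m s) *s x t\<close>.\<close>

lemma psd_Cauchy_Schwarz_sum:
  assumes "psd A"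
  shows "Re (sesq A (\<Sum>s\<in>S. m s *s x s) (\<Sum>s\<in>S. m s *s x s))
           \<le> (\<Sum>s\<in>S. (cmod (m s))\<^sup>2) * (\<Sum>s\<in>S. Re (sesq A (x s) (x s)))"
proof -
  define B where "B s t = sesq A (x s) (x t)" for s t
  define u where "u s t = cnj (m t) *s x s - cnj (m s) *s x t" for s t
  have u: "sesq A (u s t) (u s t) = of_real ((cmod (m t))\<^sup>2) * B s s + of_real ((cmod (m s))\<^sup>2) * B t t
      - cnj (m s) * m t * B s t - cnj (m t) * m s * B t s" for s t
    unfolding u_def B_def sesq_diff_left sesq_diff_right sesq_smult complex_norm_square
    by (simp add: algebra_simps)
  have Q: "sesq A (\<Sum>s\<in>S. m s *s x s) (\<Sum>s\<in>S. m s *s x s) = (\<Sum>s\<in>S. \<Sum>t\<in>S. cnj (m s) * m t * B s t)"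
    unfolding sesq_sum_left sesq_sum_right sesq_smult B_def by (rule sum.swap)
  have "0 \<le> (\<Sum>s\<in>S. \<Sum>t\<in>S. Re (sesq A (u s t) (u s t)))"
    using assms by (intro sum_nonneg) (auto simp: psd_iff_sesq)
  also have "\<dots> = Re (\<Sum>s\<in>S. \<Sum>t\<in>S. sesq A (u s t) (u s t))"
    by simp
  also have "(\<Sum>s\<in>S. \<Sum>t\<in>S. sesq A (u s t) (u s t))
      = 2 * (of_real (\<Sum>s\<in>S. (cmod (m s))\<^sup>2) * (\<Sum>s\<in>S. B s s))
        - 2 * (\<Sum>s\<in>S. \<Sum>t\<in>S. cnj (m s) * m t * B s t)"
  proof -
    have 1: "(\<Sum>s\<in>S. \<Sum>t\<in>S. cnj (m t) * m s * B t s) = (\<Sum>s\<in>S. \<Sum>t\<in>S. cnj (m s) * m t * B s t)"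
      by (rule sum.swap)
    have 2: "(\<Sum>s\<in>S. \<Sum>t\<in>S. of_real ((cmod (m s))\<^sup>2) * B t t)
        = of_real (\<Sum>s\<in>S. (cmod (m s))\<^sup>2) * (\<Sum>s\<in>S. B s s)"
      by (simp add: sum_product)
    have 3: "(\<Sum>s\<in>S. \<Sum>t\<in>S. of_real ((cmod (m t))\<^sup>2) * B s s)
        = of_real (\<Sum>s\<in>S. (cmod (m s))\<^sup>2) * (\<Sum>s\<in>S. B s s)"
      by (subst sum.swap) (rule 2)
    show ?thesis
      unfolding u sum_subtractf sum.distrib 1 2 3 by simp
  qed
  finally show ?thesis
    unfolding Q by (simp add: B_def)
qed

section \<open>The quadratic form of the tensored map in terms of pieces\<close>

text \<open>For $v = \sum_j v_j \otimes e_j$ in $C^k \otimes C^d$ this is $v_j \otimes e_i$.\<close>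

definition piece :: "complex^('k::finite \<times> 'd::finite) \<Rightarrow> 'd \<Rightarrow> 'd \<Rightarrow> complex^('k \<times> 'd)" where
  "piece v i j = (\<chi> p. if snd p = i then v $ (fst p, j) else 0)"

lemma sum_prod_UNIV:
  fixes f :: "'a::finite \<times> 'b::finite \<Rightarrow> 'c::comm_monoid_add"
  shows "(\<Sum>p\<in>UNIV. f p) = (\<Sum>a\<in>UNIV. \<Sum>b\<in>UNIV. f (a, b))"
  by (simp add: sum.cartesian_product flip: UNIV_Times_UNIV)

text \<open>The indicator in \<open>piece\<close> collapses both sums over the second tensor index
  to \<open>i\<close>. What remains is the form of the \<open>i\<close>-th diagonal slice of
  \<open>A\<close> at the vector \<open>v_j\<close>.\<close>

lemma sesq_piece:
  fixes A :: "complex^('k::finite \<times> 'd::finite)^('k \<times> 'd)"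
  shows "sesq A (piece v i j) (piece v i j)
     = (\<Sum>r\<in>UNIV. \<Sum>s\<in>UNIV. cnj (v $ (r, j)) * A $ (r, i) $ (s, i) * v $ (s, j))"
proof -
  have pull: "(\<Sum>s\<in>UNIV. if P then f s else 0) = (if P then \<Sum>s\<in>UNIV. f s else 0)"
    for P and f :: "'k \<Rightarrow> complex" by simp
  show ?thesis
    by (simp add: sesq_def piece_def sum_prod_UNIV if_distrib[of cnj] if_distrib[of "\<lambda>z. z * _"]
        if_distrib[of "\<lambda>z. _ * z"] pull cong: if_cong)
qed

lemma id_tensor_nth:
  "id_tensor \<Phi> A $ (r, a) $ (s, b) = blinfun_apply \<Phi> (block A r s) $ a $ b"
  by (simp add: id_tensor_def)

lemma blinfun_apply_Phi:
  "blinfun_apply (Phi \<alpha> \<beta> :: 'd::finite mat_map) X $ a $ b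
     = of_real (1 - \<alpha> - \<beta>) * X $ a $ b
       + (if a = b then of_real (\<alpha> / real CARD('d)) * trace X + of_real \<beta> * X $ a $ a else 0)"
  by (simp add: Phi_def blinfun.bilinear_simps tau0.rep_eq Delta.rep_eq mat_def) (simp add: scaleR_conv_of_real)

text \<open>The identity reproduces the form of \<open>A\<close>. \<open>tau0\<close> replaces the
  \<open>(r, s)\<close> block by its trace, the sum over \<open>i\<close> of
  \<open>A $ (r, i) $ (s, i)\<close>, on the diagonal; paired with \<open>v_j\<close> on both sides
  this gives all pieces. \<open>Delta\<close> keeps only the pieces with
  \<open>i = j\<close>.\<close>

lemma sesq_id_tensor_Phi:
  fixes A :: "complex^('k::finite \<times> 'd::finite)^('k \<times> 'd)"
  shows "sesq (id_tensor (Phi \<alpha> \<beta>) A) v v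
     = of_real (1 - \<alpha> - \<beta>) * sesq A v v
       + of_real (\<alpha> / real CARD('d)) * (\<Sum>i\<in>UNIV. \<Sum>j\<in>UNIV. sesq A (piece v i j) (piece v i j))
       + of_real \<beta> * (\<Sum>j\<in>UNIV. sesq A (piece v j j) (piece v j j))"
proof -
  define c where "c = (of_real (1 - \<alpha> - \<beta>) :: complex)"
  define a where "a = (of_real (\<alpha> / real CARD('d)) :: complex)"
  define b where "b = (of_real \<beta> :: complex)"
  have "sesq (id_tensor (Phi \<alpha> \<beta>) A) v v
      = (\<Sum>r\<in>UNIV. \<Sum>i\<in>UNIV. \<Sum>s\<in>UNIV. \<Sum>j\<in>UNIV. c * (cnj (v $ (r,i)) * A $ (r,i) $ (s,j) * v $ (s,j)))
      + (\<Sum>r\<in>UNIV. \<Sum>j\<in>UNIV. \<Sum>s\<in>UNIV. \<Sum>i\<in>UNIV. a * (cnj (v $ (r,j)) * A $ (r,i) $ (s,i) * v $ (s,j)))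
      + (\<Sum>r\<in>UNIV. \<Sum>j\<in>UNIV. \<Sum>s\<in>UNIV. b * (cnj (v $ (r,j)) * A $ (r,j) $ (s,j) * v $ (s,j)))"
    unfolding sum.distrib[symmetric]
    unfolding sesq_def sum_prod_UNIV id_tensor_nth blinfun_apply_Phi c_def[symmetric] a_def[symmetric] b_def[symmetric]
    apply (intro sum.cong refl)
    apply (simp add: distrib_left distrib_right sum.distrib block_def trace_def if_distrib[of "\<lambda>z. z * _"] if_distrib[of "\<lambda>z. _ * z"] cong: if_cong)
    apply (simp add: algebra_simps sum_distrib_left sum_distrib_right)
    done
  also have "(\<Sum>r\<in>UNIV. \<Sum>i\<in>UNIV. \<Sum>s\<in>UNIV. \<Sum>j\<in>UNIV. c * (cnj (v $ (r,i)) * A $ (r,i) $ (s,j) * v $ (s,j)))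
      = c * sesq A v v"
    by (simp add: sesq_def sum_prod_UNIV sum_distrib_left)
  also have "(\<Sum>r\<in>UNIV. \<Sum>j\<in>UNIV. \<Sum>s\<in>UNIV. \<Sum>i\<in>UNIV. a * (cnj (v $ (r,j)) * A $ (r,i) $ (s,i) * v $ (s,j)))
      = a * (\<Sum>i\<in>UNIV. \<Sum>j\<in>UNIV. sesq A (piece v i j) (piece v i j))"
  proof -
    \<comment> \<open>The order \<open>r, j, s, i\<close> becomes \<open>i, j, r, s\<close> by
      adjacent swaps, so that the inner double sum is the right side of
      \<open>sesq_piece\<close>.\<close>
    let ?g = "\<lambda>r j s i. a * (cnj (v $ (r,j)) * A $ (r,i) $ (s,i) * v $ (s,j))"
    have "(\<Sum>r\<in>UNIV. \<Sum>j\<in>UNIV. \<Sum>s\<in>UNIV. \<Sum>i\<in>UNIV. ?g r j s i)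
        = (\<Sum>j\<in>UNIV. \<Sum>r\<in>UNIV. \<Sum>s\<in>UNIV. \<Sum>i\<in>UNIV. ?g r j s i)"
      by (rule sum.swap)
    also have "\<dots> = (\<Sum>j\<in>UNIV. \<Sum>r\<in>UNIV. \<Sum>i\<in>UNIV. \<Sum>s\<in>UNIV. ?g r j s i)"
      by (intro sum.cong refl sum.swap)
    also have "\<dots> = (\<Sum>j\<in>UNIV. \<Sum>i\<in>UNIV. \<Sum>r\<in>UNIV. \<Sum>s\<in>UNIV. ?g r j s i)"
      by (intro sum.cong refl sum.swap)
    also have "\<dots> = (\<Sum>i\<in>UNIV. \<Sum>j\<in>UNIV. \<Sum>r\<in>UNIV. \<Sum>s\<in>UNIV. ?g r j s i)"
      by (rule sum.swap)
    finally show ?thesis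
      by (simp add: sesq_piece sum_distrib_left)
  qed
  also have "(\<Sum>r\<in>UNIV. \<Sum>j\<in>UNIV. \<Sum>s\<in>UNIV. b * (cnj (v $ (r,j)) * A $ (r,j) $ (s,j) * v $ (s,j)))
      = b * (\<Sum>j\<in>UNIV. sesq A (piece v j j) (piece v j j))"
    by (subst sum.swap) (simp add: sesq_piece sum_distrib_left)
  finally show ?thesis by (simp only: c_def a_def b_def)
qed

text \<open>Every value of a positive semidefinite form is real, so the whole right side of
  \<open>sesq_id_tensor_Phi\<close> is real and only its sign has to be checked.\<close>

lemma k_positive_PhiI:
  assumes "\<And>(A :: complex^('k::finite \<times> 'd::finite)^('k \<times> 'd)) v. psd A \<Longrightarrow>
      0 \<le> (1 - \<alpha> - \<beta>) * Re (sesq A v v)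
        + \<alpha> / real CARD('d) * (\<Sum>i\<in>UNIV. \<Sum>j\<in>UNIV. Re (sesq A (piece v i j) (piece v i j)))
        + \<beta> * (\<Sum>j\<in>UNIV. Re (sesq A (piece v j j) (piece v j j)))"
  shows "k_positive TYPE('k) (Phi \<alpha> \<beta> :: 'd mat_map)"
  unfolding k_positive_def
proof (intro allI impI)
  fix A :: "complex^('k \<times> 'd)^('k \<times> 'd)"
  assume A: "psd A"
  have R: "sesq A w w = of_real (Re (sesq A w w))" for w
    using A by (simp add: psd_iff_sesq)
  have "sesq (id_tensor (Phi \<alpha> \<beta>) A) v v = of_real ((1 - \<alpha> - \<beta>) * Re (sesq A v v)
        + \<alpha> / real CARD('d) * (\<Sum>i\<in>UNIV. \<Sum>j\<in>UNIV. Re (sesq A (piece v i j) (piece v i j)))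
        + \<beta> * (\<Sum>j\<in>UNIV. Re (sesq A (piece v j j) (piece v j j))))" for v
    unfolding sesq_id_tensor_Phi of_real_add of_real_mult of_real_sum R[symmetric] by (rule refl)
  then show "psd (id_tensor (Phi \<alpha> \<beta>) A)"
    unfolding psd_iff_sesq using assms[OF A] by (simp del: of_real_add of_real_mult)
qed

section \<open>Bounds of the form by sums over its pieces\<close>

lemma sum_piece: "(\<Sum>j\<in>UNIV. piece v j j) = v"
  by (simp add: vec_eq_iff piece_def)

text \<open>The vector is the sum of its \<open>d\<close> diagonal pieces; Cauchy-Schwarz with all
  weights 1 costs the factor \<open>d\<close>.\<close>

lemma sesq_le_sum_pieces_diag:
  fixes A :: "complex^('k::finite \<times> 'd::finite)^('k \<times> 'd)"
  assumes "psd A"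
  shows "Re (sesq A v v) \<le> real CARD('d) * (\<Sum>j\<in>UNIV. Re (sesq A (piece v j j) (piece v j j)))"
  using psd_Cauchy_Schwarz_sum[OF assms, where S = UNIV and m = "\<lambda>_. 1" and x = "\<lambda>j. piece v j j"]
  by (simp add: sum_piece)

text \<open>A matrix with fewer rows than columns cannot be injective. The unit length is what turns
  the coefficient matrix built from \<open>w\<close> below into a projection.\<close>

lemma unit_kernel_vector:
  fixes M :: "complex^'d::finite^'k::finite"
  assumes "CARD('k) < CARD('d)"
  obtains w where "M *v w = 0" and "(\<Sum>j\<in>UNIV. (cmod (w $ j))\<^sup>2) = 1"
proof -
  have "\<not> inj ((*v) M)"
  proof
    assume inj: "inj ((*v) M)"
    have "vec.dim (range ((*v) M)) = vec.dim (UNIV :: (complex^'d) set)"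
      using inj by (intro vec.dim_image_eq matrix_vector_mul_linear_gen) auto
    moreover have "vec.dim (range ((*v) M)) \<le> CARD('k)"
      using vec.dim_subset[OF subset_UNIV, of "range ((*v) M)"] by (simp only: vec_dim_card)
    ultimately have "CARD('d) \<le> CARD('k)" by (simp only: vec_dim_card)
    then show False using assms by simp
  qed
  then obtain x y where "x \<noteq> y" "M *v x = M *v y" by (auto simp: inj_def)
  then have z: "M *v (x - y) = 0" "x - y \<noteq> 0"
    by (auto simp: matrix_vector_mult_diff_distrib)
  define w where "w = (1 / norm (x - y)) *\<^sub>R (x - y)"
  have "M *v w = (1 / norm (x - y)) *\<^sub>R (M *v (x - y))"
    by (simp add: w_def vec_eq_iff matrix_vector_mult_def scaleR_sum_right del: vector_minus_component)
  then have "M *v w = 0"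
    using z by simp
  moreover have "norm w = 1" using z by (simp add: w_def)
  then have "(\<Sum>j\<in>UNIV. (cmod (w $ j))\<^sup>2) = 1"
    by (simp add: norm_vec_def L2_set_def)
  ultimately show ?thesis by (rule that)
qed

text \<open>As \<open>k < d\<close>, the vectors $v_j$ satisfy a linear relation $\sum_j w_j v_j = 0$, so in
  $v = \sum_j v_j \otimes e_j$ the coefficient matrix \<open>1\<close> may be replaced by a projection of
  rank \<open>d - 1\<close>, whose squared Frobenius norm is \<open>d - 1\<close>.\<close>

lemma sesq_le_sum_pieces:
  fixes A :: "complex^('k::finite \<times> 'd::finite)^('k \<times> 'd)"
  assumes "psd A" and "CARD('k) < CARD('d)"
  shows "Re (sesq A v v)
    \<le> (real CARD('d) - 1) * (\<Sum>i\<in>UNIV. \<Sum>j\<in>UNIV. Re (sesq A (piece v i j) (piece v i j)))"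
proof -
  obtain w where w: "(\<chi> r j. v $ (r, j)) *v w = 0" and n: "(\<Sum>j\<in>UNIV. (cmod (w $ j))\<^sup>2) = 1"
    using unit_kernel_vector[OF assms(2)] by blast
  \<comment> \<open>The orthogonal projection onto the complement of the conjugate of
    \<open>w\<close>. Its row \<open>e\<close> maps the \<open>v_j\<close> to \<open>v_e\<close>
    minus \<open>cnj (w $ e)\<close> times the sum of the \<open>w_j v_j\<close>; that sum is zero,
    so \<open>v\<close> is unchanged.\<close>
  define m where "m p = (if fst p = snd p then 1 else 0) - cnj (w $ fst p) * w $ snd p" for p
  define x where "x p = piece v (fst p) (snd p)" for p
  have w0: "(\<Sum>j\<in>UNIV. v $ (r, j) * w $ j) = 0" for r
    using arg_cong[OF w, of "\<lambda>u. u $ r"] by (simp add: matrix_vector_mult_def)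
  have v: "(\<Sum>p\<in>UNIV. m p *s x p) = v"
  proof (subst vec_eq_iff, rule allI)
    fix q :: "'k \<times> 'd"
    obtain r e where q: "q = (r, e)" by (cases q)
    have "(\<Sum>p\<in>UNIV. m p *s x p) $ q = (\<Sum>i\<in>UNIV. \<Sum>j\<in>UNIV. if i = e then m (i, j) * v $ (r, j) else 0)"
      unfolding sum_prod_UNIV by (auto simp: x_def piece_def q intro!: sum.cong)
    also have "\<dots> = (\<Sum>j\<in>UNIV. m (e, j) * v $ (r, j))"
      by (subst sum.swap) simp
    also have "\<dots> = (\<Sum>j\<in>UNIV. (if e = j then v $ (r, j) else 0) - cnj (w $ e) * (v $ (r, j) * w $ j))"
      by (intro sum.cong refl) (simp add: m_def algebra_simps)
    also have "\<dots> = v $ q"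
      by (simp add: sum_subtractf sum_distrib_left[symmetric] w0 q)
    finally show "(\<Sum>p\<in>UNIV. m p *s x p) $ q = v $ q" .
  qed
  \<comment> \<open>On the diagonal this is the square of \<open>1 - |w_i|^2\<close>. Summed over
    all \<open>i, j\<close> with \<open>w\<close> of unit length, it gives
    \<open>d - 2 + 1 = d - 1\<close>.\<close>
  have "(cmod (m (i, j)))\<^sup>2 = (if i = j then 1 - 2 * (cmod (w $ i))\<^sup>2 else 0)
      + (cmod (w $ i))\<^sup>2 * (cmod (w $ j))\<^sup>2" for i j
  proof (cases "i = j")
    case True
    have "m (i, j) = of_real (1 - (cmod (w $ i))\<^sup>2)"
      using True by (simp add: m_def complex_norm_square mult.commute del: of_real_power)
    then show ?thesis
      using True by (simp del: of_real_diff add: power2_eq_square algebra_simps)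
  next
    case False
    then show ?thesis by (simp add: m_def norm_mult power_mult_distrib)
  qed
  then have m: "(\<Sum>p\<in>UNIV. (cmod (m p))\<^sup>2) = real CARD('d) - 1"
    unfolding sum_prod_UNIV
    by (simp add: sum.distrib sum_subtractf n flip: sum_distrib_left)
  show ?thesis
    using psd_Cauchy_Schwarz_sum[OF assms(1), where S = UNIV and m = m and x = x]
    unfolding v m by (simp add: sum_prod_UNIV x_def)
qed

section \<open>Positivity of the four corners\<close>

lemma k_positive_Psi0: "k_positive TYPE('k::finite) (Psi0 :: 'd::finite mat_map)"
  unfolding Psi0_def by (rule k_positive_PhiI) (simp add: psd_iff_sesq)

text \<open>The identity has coefficient \<open>-1/(d - 1)\<close>, so the condition is
  \<open>sesq_le_sum_pieces_diag\<close> divided by \<open>d - 1\<close>.\<close>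

lemma k_positive_Psi1:
  assumes "CARD('d::finite) \<ge> 2"
  shows "k_positive TYPE('k::finite) (Psi1 :: 'd mat_map)"
  unfolding Psi1_def
proof (rule k_positive_PhiI)
  fix A :: "complex^('k \<times> 'd)^('k \<times> 'd)" and v
  assume A: "psd A"
  let ?D = "real CARD('d)"
  let ?S = "\<Sum>j\<in>UNIV. Re (sesq A (piece v j j) (piece v j j))"
  have "(1 - 0 - ?D / (?D - 1)) * Re (sesq A v v) + 0 / ?D * s + ?D / (?D - 1) * ?S
      = (?D * ?S - Re (sesq A v v)) / (?D - 1)" for s
    using assms by (simp add: divide_simps)
  then show "0 \<le> (1 - 0 - ?D / (?D - 1)) * Re (sesq A v v)
      + 0 / ?D * (\<Sum>i\<in>UNIV. \<Sum>j\<in>UNIV. Re (sesq A (piece v i j) (piece v i j)))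
      + ?D / (?D - 1) * ?S"
    using sesq_le_sum_pieces_diag[OF A, of v] assms by simp
qed

text \<open>The coefficient of the identity vanishes. What is left is \<open>1/(d - 1)\<close> times
  the sum of the off-diagonal pieces, each of them nonnegative.\<close>

lemma k_positive_Psi2:
  assumes "CARD('d::finite) \<ge> 2"
  shows "k_positive TYPE('k::finite) (Psi2 :: 'd mat_map)"
  unfolding Psi2_def
proof (rule k_positive_PhiI)
  fix A :: "complex^('k \<times> 'd)^('k \<times> 'd)" and v
  assume A: "psd A"
  let ?D = "real CARD('d)"
  let ?q = "\<lambda>i j. Re (sesq A (piece v i j) (piece v i j))"
  have "0 \<le> ?q i j" for i j
    using A by (simp add: psd_iff_sesq)
  then have "(\<Sum>j\<in>UNIV. ?q j j) \<le> (\<Sum>i\<in>UNIV. \<Sum>j\<in>UNIV. ?q i j)"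
    by (intro sum_mono member_le_sum) auto
  moreover have "1 - ?D / (?D - 1) - - 1 / (?D - 1) = 0"
    using assms by (simp add: divide_simps)
  then have "(1 - ?D / (?D - 1) - - 1 / (?D - 1)) * Re (sesq A v v) + ?D / (?D - 1) / ?D * s
      + - 1 / (?D - 1) * t = (s - t) / (?D - 1)" for s t
    by (simp add: diff_divide_distrib)
  ultimately show "0 \<le> (1 - ?D / (?D - 1) - - 1 / (?D - 1)) * Re (sesq A v v)
      + ?D / (?D - 1) / ?D * (\<Sum>i\<in>UNIV. \<Sum>j\<in>UNIV. ?q i j) + - 1 / (?D - 1) * (\<Sum>j\<in>UNIV. ?q j j)"
    using assms by simp
qed

text \<open>With \<alpha> = kd/(kd - 1) the identity has coefficient \<open>-1/(kd - 1)\<close>, and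
  \<alpha>/d = k/(kd - 1). The condition is therefore \<open>sesq_le_sum_pieces\<close>, whose
  constant \<open>d - 1\<close> equals \<open>k\<close>.\<close>

lemma k_positive_T_map:
  assumes "CARD('d::finite) \<ge> 3" and "CARD('k::finite) = CARD('d) - 1"
  shows "k_positive TYPE('k) (T_map CARD('k) :: 'd mat_map)"
  unfolding T_map_def
proof (rule k_positive_PhiI)
  fix A :: "complex^('k \<times> 'd)^('k \<times> 'd)" and v
  assume A: "psd A"
  let ?D = "real CARD('d)" and ?k = "real CARD('k)"
  let ?F = "\<Sum>i\<in>UNIV. \<Sum>j\<in>UNIV. Re (sesq A (piece v i j) (piece v i j))"
  have k: "?k = ?D - 1" using assms by simp
  have n: "?k * ?D - 1 > 0"
    using mult_mono[of 2 ?k 3 ?D] assms k by simp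
  define N where "N = ?k * ?D - 1"
  have N: "?k * ?D = N + 1" "?k / N = ?k * ?D / N / ?D"
    using assms by (auto simp: N_def)
  have "(1 - ?k * ?D / (?k * ?D - 1) - 0) * Re (sesq A v v) + ?k * ?D / (?k * ?D - 1) / ?D * ?F + 0 * t
      = (?k * ?F - Re (sesq A v v)) / (?k * ?D - 1)" for t
    unfolding N_def[symmetric] N(2)[symmetric] using n
    unfolding N_def[symmetric] N(1) by (simp add: field_simps)
  moreover have "Re (sesq A v v) \<le> ?k * ?F"
    unfolding k using assms by (intro sesq_le_sum_pieces A) auto
  ultimately show "0 \<le> (1 - ?k * ?D / (?k * ?D - 1) - 0) * Re (sesq A v v)
      + ?k * ?D / (?k * ?D - 1) / ?D * ?F
      + 0 * (\<Sum>j\<in>UNIV. Re (sesq A (piece v j j) (piece v j j)))"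
    using n by simp
qed

section \<open>Convexity and the affine parametrisation of the family\<close>

lemma convex_k_positive: "convex {\<Phi> :: 'd::finite mat_map. k_positive TYPE('k::finite) \<Phi>}"
proof (rule convexI, clarify)
  fix \<Phi> \<Psi> :: "'d mat_map" and s t :: real
  assume *: "k_positive TYPE('k) \<Phi>" "k_positive TYPE('k) \<Psi>" "0 \<le> s" "0 \<le> t"
  have "sesq (id_tensor (s *\<^sub>R \<Phi> + t *\<^sub>R \<Psi>) A) v v
      = of_real s * sesq (id_tensor \<Phi> A) v v + of_real t * sesq (id_tensor \<Psi> A) v v"
    for A :: "complex^('k \<times> 'd)^('k \<times> 'd)" and v
    by (simp add: sesq_def id_tensor_def blinfun.bilinear_simps sum_distrib_left
        flip: sum.distrib) (simp add: scaleR_conv_of_real algebra_simps)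
  then show "k_positive TYPE('k) (s *\<^sub>R \<Phi> + t *\<^sub>R \<Psi>)"
    using * by (simp add: k_positive_def psd_iff_sesq)
qed

text \<open>Exhibits the family as an affine image of the plane, with base point the identity and
  directions \<open>tau0 - id_blinfun\<close> and \<open>Delta - id_blinfun\<close>.\<close>

lemma Phi_eq: "Phi \<alpha> \<beta> = id_blinfun + \<alpha> *\<^sub>R (tau0 - id_blinfun) + \<beta> *\<^sub>R (Delta - id_blinfun)"
  by (simp add: Phi_def algebra_simps)

lemma Phi_affine:
  "(1 - s - t) *\<^sub>R Phi \<alpha> \<beta> + s *\<^sub>R Phi \<alpha>' \<beta>' + t *\<^sub>R Phi \<alpha>'' \<beta>''
     = Phi ((1 - s - t) * \<alpha> + s * \<alpha>' + t * \<alpha>'') ((1 - s - t) * \<beta> + s * \<beta>' + t * \<beta>'')"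
  by (simp add: Phi_eq algebra_simps)

lemma convex_range_Phi: "convex {\<Phi> :: 'd::finite mat_map. \<exists>\<alpha> \<beta>. \<Phi> = Phi \<alpha> \<beta>}"
proof (rule convexI, clarify)
  fix s t :: real and a b a' b'
  assume "s + t = 1"
  then have "s *\<^sub>R Phi a b + t *\<^sub>R Phi a' b' = (Phi (s * a + t * a') (s * b + t * b') :: 'd mat_map)"
    \<comment> \<open>The third point gets weight 0, and \<open>s = 1 - t\<close>.\<close>
    using Phi_affine[of t 0 a b a' b' 0 0] by (simp add: eq_diff_eq[symmetric])
  then show "\<exists>\<alpha> \<beta>. s *\<^sub>R Phi a b + t *\<^sub>R Phi a' b' = (Phi \<alpha> \<beta> :: 'd mat_map)"
    by blast
qed

section \<open>Necessary inequalities from rank-one test matrices\<close>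

text \<open>Necessary condition from the rank-one matrix of $\sum_i u_i \otimes e_i$; the matrix \<open>G\<close>
  ranges over all real matrices of rank at most \<open>k\<close>.\<close>

lemma k_positive_Phi_Gram:
  fixes u v :: "'d::finite \<Rightarrow> 'k::finite \<Rightarrow> real"
  assumes "k_positive TYPE('k) (Phi \<alpha> \<beta> :: 'd mat_map)"
    and G: "\<And>i j. (\<Sum>r\<in>UNIV. u i r * v j r) = G i j"
  shows "0 \<le> (1 - \<alpha> - \<beta>) * (\<Sum>i\<in>UNIV. G i i)\<^sup>2
        + \<alpha> / real CARD('d) * (\<Sum>i\<in>UNIV. \<Sum>j\<in>UNIV. (G i j)\<^sup>2)
        + \<beta> * (\<Sum>i\<in>UNIV. (G i i)\<^sup>2)"
proof -
  define A :: "complex^('k \<times> 'd)^('k \<times> 'd)"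
    where "A = (\<chi> p q. of_real (u (snd p) (fst p)) * of_real (u (snd q) (fst q)))"
  define V :: "complex^('k \<times> 'd)" where "V = (\<chi> p. of_real (v (snd p) (fst p)))"
  \<comment> \<open>The functional whose squared modulus is the form of \<open>A\<close>. Pairing
    the \<open>u_i\<close> with \<open>V\<close> gives the trace of \<open>G\<close>; pairing them
    with \<open>piece V i j\<close> gives the single entry \<open>G i j\<close>.\<close>
  define z where "z x = (\<Sum>p\<in>UNIV. of_real (u (snd p) (fst p)) * x $ p)" for x :: "complex^('k \<times> 'd)"
  have z: "sesq A x x = of_real ((cmod (z x))\<^sup>2)" for x
  proof -
    have "sesq A x x = cnj (z x) * z x"
      unfolding z_def cnj_sum sum_product sesq_def A_def by (simp add: mult_ac)
    then show ?thesis
      unfolding complex_norm_square by (simp add: mult.commute)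
  qed
  have "psd A"
    unfolding psd_iff_sesq z by simp
  then have "psd (id_tensor (Phi \<alpha> \<beta> :: 'd mat_map) A)"
    using assms(1) by (simp add: k_positive_def)
  then have *: "0 \<le> Re (sesq (id_tensor (Phi \<alpha> \<beta>) A) V V)"
    by (simp add: psd_iff_sesq)
  have "z V = of_real (\<Sum>i\<in>UNIV. G i i)"
    unfolding z_def V_def sum_prod_UNIV by (subst sum.swap) (simp flip: G)
  then have zV: "cmod (z V) = \<bar>\<Sum>i\<in>UNIV. G i i\<bar>"
    by (metis norm_of_real)
  have "z (piece V i j) = of_real (G i j)" for i j
    unfolding z_def V_def sum_prod_UNIV piece_def
    by (simp add: if_distrib[of "\<lambda>z. _ * z"] flip: G cong: if_cong)
  then have zp: "cmod (z (piece V i j)) = \<bar>G i j\<bar>" for i j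
    by simp
  have "sesq (id_tensor (Phi \<alpha> \<beta>) A) V V = of_real ((1 - \<alpha> - \<beta>) * (\<Sum>i\<in>UNIV. G i i)\<^sup>2
        + \<alpha> / real CARD('d) * (\<Sum>i\<in>UNIV. \<Sum>j\<in>UNIV. (G i j)\<^sup>2)
        + \<beta> * (\<Sum>i\<in>UNIV. (G i i)\<^sup>2))"
    unfolding sesq_id_tensor_Phi z zV zp by simp
  then show ?thesis using * by (simp only: Re_complex_of_real)
qed

lemma ex_distinct:
  assumes "CARD('a::finite) \<ge> 2"
  obtains i j :: "'a::finite" where "i \<noteq> j"
  using assms by (metis card_le_Suc0_iff_eq finite not_less_eq_eq numeral_2_eq_2)

text \<open>The test matrix is an off-diagonal matrix unit: its diagonal is zero, so only the
  \<open>tau0\<close> term survives. This is the edge from \<open>Psi0\<close> to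
  \<open>Psi1\<close>.\<close>

lemma k_positive_Phi_imp_ge_0:
  assumes "k_positive TYPE('k::finite) (Phi \<alpha> \<beta> :: 'd::finite mat_map)" and "CARD('d) \<ge> 2"
  shows "0 \<le> \<alpha>"
proof -
  obtain i j :: 'd where ij: "i \<noteq> j"
    using assms(2) by (rule ex_distinct)
  define r :: 'k where "r = undefined"
  define u :: "'d \<Rightarrow> 'k \<Rightarrow> real" where "u a t = of_bool (a = i) * of_bool (t = r)" for a t
  define v :: "'d \<Rightarrow> 'k \<Rightarrow> real" where "v b t = of_bool (b = j) * of_bool (t = r)" for b t
  define G :: "'d \<Rightarrow> 'd \<Rightarrow> real" where "G a b = of_bool (a = i) * of_bool (b = j)" for a b
  have "(\<Sum>t\<in>UNIV. u a t * v b t) = (\<Sum>t\<in>{r}. u a t * v b t)" for a b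
    by (rule sum.mono_neutral_right) (auto simp: u_def v_def)
  then have G: "(\<Sum>t\<in>UNIV. u a t * v b t) = G a b" for a b
    by (simp add: u_def v_def G_def)
  have tr: "G a a = 0" for a
    using ij by (simp add: G_def)
  have "(G a b)\<^sup>2 = of_bool (a = i) * of_bool (b = j)" for a b
    by (simp add: G_def)
  then have fr: "(\<Sum>a\<in>UNIV. \<Sum>b\<in>UNIV. (G a b)\<^sup>2) = 1"
    by (simp flip: sum_distrib_left)
  have "0 \<le> \<alpha> / real CARD('d)"
    using k_positive_Phi_Gram[OF assms(1), where G = G, OF G] unfolding tr fr by simp
  then show ?thesis using assms(2) by (simp add: zero_le_divide_iff)
qed

text \<open>The test matrix \<open>E_ii - E_jj\<close> has trace zero, which removes the identity
  term. Its rank is two, hence the bound on \<open>CARD('k)\<close>; for \<open>k = d - 1\<close>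
  this means that \<open>d\<close> is at least 3. This is the edge from \<open>Psi0\<close> to
  \<open>Psi2\<close>.\<close>

lemma k_positive_Phi_imp_diag_ge_0:
  assumes "k_positive TYPE('k::finite) (Phi \<alpha> \<beta> :: 'd::finite mat_map)"
    and "CARD('d) \<ge> 2" and "CARD('k) \<ge> 2"
  shows "0 \<le> \<alpha> / real CARD('d) + \<beta>"
proof -
  obtain i j :: 'd where ij: "i \<noteq> j"
    using assms(2) by (rule ex_distinct)
  obtain r s :: 'k where rs: "r \<noteq> s"
    using assms(3) by (rule ex_distinct)
  define u :: "'d \<Rightarrow> 'k \<Rightarrow> real" where "u a t = of_bool (a = i) * of_bool (t = r) + of_bool (a = j) * of_bool (t = s)" for a t
  define v :: "'d \<Rightarrow> 'k \<Rightarrow> real" where "v a t = of_bool (a = i) * of_bool (t = r) - of_bool (a = j) * of_bool (t = s)" for a t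
  define G :: "'d \<Rightarrow> 'd \<Rightarrow> real" where "G a b = (if a = b then of_bool (a = i) - of_bool (a = j) else 0)" for a b
  have "(\<Sum>t\<in>UNIV. u a t * v b t) = (\<Sum>t\<in>{r, s}. u a t * v b t)" for a b
    by (rule sum.mono_neutral_right) (auto simp: u_def v_def)
  then have G: "(\<Sum>t\<in>UNIV. u a t * v b t) = G a b" for a b
    using ij rs by (auto simp: u_def v_def G_def)
  have sq: "(G a b)\<^sup>2 = (if a = b then of_bool (a = i) + of_bool (a = j) else 0)" for a b
    using ij by (simp add: G_def)
  have tr: "(\<Sum>a\<in>UNIV. G a a) = 0"
    by (simp add: G_def sum_subtractf)
  have "0 \<le> 2 * (\<alpha> / real CARD('d) + \<beta>)"
    using k_positive_Phi_Gram[OF assms(1), where G = G, OF G] unfolding tr sq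
    by (simp add: sum.distrib distrib_left mult.commute)
  then show ?thesis by simp
qed

text \<open>Reindexing along \<open>h\<close>, which identifies the coordinates of
  \<open>C^k\<close> with those of \<open>C^d\<close> other than \<open>e\<close>. The second sum is
  the diagonal projection that kills \<open>e\<close>, factored through \<open>C^k\<close>.\<close>

lemma sum_of_bool_bij_betw:
  fixes h :: "'k::finite \<Rightarrow> 'd::finite"
  assumes "bij_betw h UNIV (UNIV - {e})"
  shows "(\<Sum>r\<in>UNIV. of_bool (a = h r)) = (of_bool (a \<noteq> e) :: real)"
    and "(\<Sum>r\<in>UNIV. of_bool (a = h r) * of_bool (b = h r)) = (of_bool (a \<noteq> e \<and> a = b) :: real)"
proof -
  have *: "(\<Sum>r\<in>UNIV. f (h r)) = (\<Sum>c\<in>UNIV - {e}. f c)" for f :: "_ \<Rightarrow> real"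
    by (rule sum.reindex_bij_betw[OF assms])
  show "(\<Sum>r\<in>UNIV. of_bool (a = h r)) = (of_bool (a \<noteq> e) :: real)"
    unfolding *[of "\<lambda>c. of_bool (a = c)"] by (simp add: of_bool_def)
  show "(\<Sum>r\<in>UNIV. of_bool (a = h r) * of_bool (b = h r)) = (of_bool (a \<noteq> e \<and> a = b) :: real)"
    unfolding *[of "\<lambda>c. of_bool (a = c) * of_bool (b = c)"]
    by (cases "a = b") (auto simp: of_bool_def if_distrib[of "\<lambda>z. z * _"]
        cong: if_cong intro!: sum.neutral)
qed

lemma ex_bij_betw_UNIV_minus_singleton:
  assumes "CARD('k::finite) = CARD('d::finite) - 1"
  obtains e and h :: "'k::finite \<Rightarrow> 'd::finite" where "bij_betw h UNIV (UNIV - {e})"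
proof -
  have "\<exists>h :: 'k \<Rightarrow> 'd. bij_betw h UNIV (UNIV - {undefined})"
    by (rule finite_same_card_bij) (use assms in auto)
  then obtain h :: "'k \<Rightarrow> 'd" where "bij_betw h UNIV (UNIV - {undefined})" ..
  then show ?thesis by (rule that)
qed

text \<open>The diagonal projection of rank \<open>k\<close> has trace, squared Frobenius norm and
  sum of squared diagonal entries all equal to \<open>k\<close>; one factor \<open>k\<close> is then
  cancelled. This is the edge from \<open>Psi2\<close> to \<open>T_map\<close>.\<close>

lemma k_positive_Phi_imp_trace_ge_0:
  assumes pos: "k_positive TYPE('k::finite) (Phi \<alpha> \<beta> :: 'd::finite mat_map)"
    and d: "CARD('d) \<ge> 2" and k: "CARD('k) = CARD('d) - 1"
  shows "0 \<le> (real CARD('d) - 1) * (1 - \<alpha> - \<beta>) + \<alpha> / real CARD('d) + \<beta>"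
proof -
  obtain e and h :: "'k \<Rightarrow> 'd" where h: "bij_betw h UNIV (UNIV - {e})"
    using ex_bij_betw_UNIV_minus_singleton[OF k] .
  let ?k = "real CARD('d) - 1"
  let ?u = "\<lambda>a r. of_bool (a = h r) :: real"
  let ?G = "\<lambda>a b. of_bool (a \<noteq> e \<and> a = b) :: real"
  have c: "(\<Sum>a\<in>UNIV. of_bool (a \<noteq> e)) = ?k"
    by (subst sum.remove[of _ e]) (auto simp: of_nat_diff Suc_le_eq)
  have sq: "(?G a b)\<^sup>2 = ?G a b" for a b by (simp add: of_bool_def)
  have r: "(\<Sum>b\<in>UNIV. ?G a b) = of_bool (a \<noteq> e)" for a by (cases "a = e") (simp_all add: of_bool_def)
  have "0 \<le> (1 - \<alpha> - \<beta>) * (\<Sum>i\<in>UNIV. ?G i i)\<^sup>2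
      + \<alpha> / real CARD('d) * (\<Sum>i\<in>UNIV. \<Sum>j\<in>UNIV. (?G i j)\<^sup>2) + \<beta> * (\<Sum>i\<in>UNIV. (?G i i)\<^sup>2)"
    by (rule k_positive_Phi_Gram[OF pos, where u = ?u and v = ?u]) (rule sum_of_bool_bij_betw(2)[OF h])
  then have "0 \<le> (1 - \<alpha> - \<beta>) * ?k\<^sup>2 + \<alpha> / real CARD('d) * ?k + \<beta> * ?k"
    unfolding sq r by (simp add: c)
  also have "\<dots> = ?k * (?k * (1 - \<alpha> - \<beta>) + \<alpha> / real CARD('d) + \<beta>)"
    by (simp only: power2_eq_square distrib_left mult_ac)
  finally show ?thesis using d by (simp add: zero_le_mult_iff)
qed

text \<open>The centering projection \<open>1 - J/d\<close> has rank, trace and squared Frobenius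
  norm \<open>d - 1\<close>, and all its diagonal entries are \<open>(d - 1)/d\<close>. This is the
  edge from \<open>Psi1\<close> to \<open>T_map\<close>.\<close>

lemma k_positive_Phi_imp_centering_ge_0:
  assumes pos: "k_positive TYPE('k::finite) (Phi \<alpha> \<beta> :: 'd::finite mat_map)"
    and d: "CARD('d) \<ge> 2" and k: "CARD('k) = CARD('d) - 1"
  shows "0 \<le> (real CARD('d) - 1) * (1 - \<alpha> - \<beta>) + \<alpha> / real CARD('d)
     + \<beta> * ((real CARD('d) - 1) / real CARD('d))"
proof -
  obtain e and h :: "'k \<Rightarrow> 'd" where h: "bij_betw h UNIV (UNIV - {e})"
    using ex_bij_betw_UNIV_minus_singleton[OF k] .
  let ?D = "real CARD('d)"
  let ?k = "?D - 1"
  \<comment> \<open>An explicit rank factorisation: for \<open>c\<close> other than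
    \<open>e\<close>, the vectors \<open>e_c - e_e\<close> and \<open>e_c - (1/d, ..., 1/d)\<close>
    form dual bases of the sum-zero hyperplane, so their products add up to the projection onto
    it.\<close>
  let ?u = "\<lambda>a r. of_bool (a = h r) - of_bool (a = e) :: real"
  let ?v = "\<lambda>a r. of_bool (a = h r) - 1 / ?D :: real"
  let ?G = "\<lambda>a b. of_bool (a = b) - 1 / ?D :: real"
  have G: "(\<Sum>r\<in>UNIV. ?u a r * ?v b r) = ?G a b" for a b
  proof -
    have "(\<Sum>r\<in>UNIV. ?u a r * ?v b r) = (\<Sum>r\<in>UNIV. of_bool (a = h r) * of_bool (b = h r))
        - (\<Sum>r\<in>UNIV. of_bool (a = h r)) / ?D - of_bool (a = e) * (\<Sum>r\<in>UNIV. of_bool (b = h r))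
        + of_bool (a = e) * real CARD('k) / ?D"
      by (simp add: algebra_simps sum.distrib sum_subtractf sum_distrib_left flip: sum_divide_distrib)
    also have "\<dots> = ?G a b"
      unfolding sum_of_bool_bij_betw[OF h] using k d by (auto simp: of_bool_def diff_divide_distrib)
    finally show ?thesis .
  qed
  have sq: "(?G a b)\<^sup>2 = of_bool (a = b) * (1 - 2 / ?D) + 1 / ?D\<^sup>2" for a b :: 'd
    by (simp add: of_bool_def power2_eq_square algebra_simps)
  have tr: "(\<Sum>i\<in>(UNIV :: 'd set). ?G i i) = ?k"
    using d by (simp add: right_diff_distrib)
  have di: "(\<Sum>i\<in>(UNIV :: 'd set). (?G i i)\<^sup>2) = ?k * (?k / ?D)"
    using d by (simp add: power2_eq_square field_simps)
  have fr: "(\<Sum>i\<in>(UNIV :: 'd set). \<Sum>j\<in>(UNIV :: 'd set). (?G i j)\<^sup>2) = ?k"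
    unfolding sq sum.distrib sum_distrib_right[symmetric] using d
    by (simp add: power2_eq_square right_diff_distrib)
  have "0 \<le> (1 - \<alpha> - \<beta>) * ?k\<^sup>2 + \<alpha> / ?D * ?k + \<beta> * (?k * (?k / ?D))"
    using k_positive_Phi_Gram[OF pos, where G = ?G, OF G] unfolding tr di fr .
  also have "\<dots> = ?k * (?k * (1 - \<alpha> - \<beta>) + \<alpha> / ?D + \<beta> * (?k / ?D))"
    by (simp only: power2_eq_square distrib_left mult_ac)
  finally show ?thesis using d by (simp add: zero_le_mult_iff)
qed

section \<open>The four inequalities cut out the hull\<close>

text \<open>The diagonal from \<open>Psi0\<close> to \<open>T_map\<close> lies on the line \<beta> =
  0 and splits the quadrilateral into two triangles, with third corner \<open>Psi1\<close> above and
  \<open>Psi2\<close> below. In each, \<open>s\<close> and \<open>t\<close> are barycentric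
  coordinates, and \<open>E3\<close> or \<open>E4\<close> says that
  \<open>s + t \<le> 1\<close>.\<close>

lemma Phi_in_convex_hull:
  assumes "CARD('d::finite) \<ge> 3" and "CARD('k::finite) = CARD('d) - 1"
    and "0 \<le> \<alpha>" and E2: "0 \<le> \<alpha> / real CARD('d) + \<beta>"
    and E4: "0 \<le> (real CARD('d) - 1) * (1 - \<alpha> - \<beta>) + \<alpha> / real CARD('d) + \<beta>"
    and E3: "0 \<le> (real CARD('d) - 1) * (1 - \<alpha> - \<beta>) + \<alpha> / real CARD('d)
              + \<beta> * ((real CARD('d) - 1) / real CARD('d))"
  shows "(Phi \<alpha> \<beta> :: 'd mat_map) \<in> convex hull {Psi0, Psi1, Psi2, T_map CARD('k)}"
proof -
  define D where "D = real CARD('d)"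
  have D: "D \<ge> 3" using assms(1) by (simp add: D_def)
  define N where "N = (D - 1) * D - 1"
  have N: "N > 0" using mult_mono[of 2 "D - 1" 3 D] D by (simp add: N_def)
  have k: "real CARD('k) = D - 1" using assms(1,2) by (simp add: D_def)
  have T: "T_map CARD('k) = (Phi ((D - 1) * D / N) 0 :: 'd mat_map)"
    by (simp add: T_map_def k N_def flip: D_def)
  have in_hull: "(1 - s - t) *\<^sub>R Psi0 + s *\<^sub>R x + t *\<^sub>R y \<in> convex hull {Psi0, Psi1, Psi2, T_map CARD('k)}"
    if "0 \<le> s" "0 \<le> t" "s + t \<le> 1" "x \<in> {Psi1, Psi2}" "y = T_map CARD('k)"
    for s t and x y :: "'d mat_map"
  proof -
    have "(1 - s - t) *\<^sub>R Psi0 + s *\<^sub>R x + t *\<^sub>R y \<in> convex hull {Psi0, x, y}"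
      unfolding convex_hull_3 using that by force
    also have "\<dots> \<subseteq> convex hull {Psi0, Psi1, Psi2, T_map CARD('k)}"
      using that by (intro hull_mono) auto
    finally show ?thesis .
  qed
  show ?thesis
  proof (cases "\<beta> \<ge> 0")
    case True
    \<comment> \<open>Among the three corners only \<open>Psi1\<close> has nonzero \<beta> and only
      \<open>T_map\<close> has nonzero \<alpha>, so each coordinate is a single quotient.\<close>
    define s where "s = \<beta> * (D - 1) / D"
    define t where "t = \<alpha> * N / ((D - 1) * D)"
    have "(D - 1) * (1 - s - t) = (D - 1) * (1 - \<alpha> - \<beta>) + \<alpha> / D + \<beta> * ((D - 1) / D)"
      using D by (simp add: s_def t_def N_def divide_simps) (simp add: algebra_simps)
    then have "0 \<le> (D - 1) * (1 - s - t)" using E3 by (simp add: D_def)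
    then have "s + t \<le> 1" using D by (simp add: zero_le_mult_iff)
    moreover have "s \<ge> 0" "t \<ge> 0" using True assms(3) D N by (simp_all add: s_def t_def)
    moreover have "Phi \<alpha> \<beta> = (1 - s - t) *\<^sub>R (Psi0 :: 'd mat_map) + s *\<^sub>R Psi1 + t *\<^sub>R T_map CARD('k)"
      unfolding Psi0_def Psi1_def T Phi_affine D_def[symmetric]
      using D N by (simp add: s_def t_def)
    ultimately show ?thesis using in_hull[of s t Psi1] by simp
  next
    case False
    \<comment> \<open>Only \<open>Psi2\<close> has nonzero \<beta>, which fixes \<open>s\<close>.
      Since \<alpha>/D + \<beta> vanishes at \<open>Psi0\<close> and \<open>Psi2\<close> and equals
      \<open>(D - 1)/N\<close> at \<open>T_map\<close>, it determines \<open>t\<close>.\<close>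
    define s where "s = - \<beta> * (D - 1)"
    define t where "t = (\<alpha> / D + \<beta>) * (N / (D - 1))"
    have "(D - 1) * (1 - s - t) = (D - 1) * (1 - \<alpha> - \<beta>) + \<alpha> / D + \<beta>"
      using D by (simp add: s_def t_def N_def divide_simps) (simp add: algebra_simps)
    then have "0 \<le> (D - 1) * (1 - s - t)" using E4 by (simp add: D_def)
    then have "s + t \<le> 1" using D by (simp add: zero_le_mult_iff)
    moreover have "s \<ge> 0" using False D by (simp add: s_def mult_nonpos_nonneg)
    moreover have "t \<ge> 0" using E2 D N by (simp add: t_def D_def)
    moreover have "Phi \<alpha> \<beta> = (1 - s - t) *\<^sub>R (Psi0 :: 'd mat_map) + s *\<^sub>R Psi2 + t *\<^sub>R T_map CARD('k)"
    proof -
      have "s * (D / (D - 1)) + t * ((D - 1) * D / N) = \<alpha>" "s * (- 1 / (D - 1)) = \<beta>"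
        using D N by (simp_all add: s_def t_def divide_simps)
      then show ?thesis
        unfolding Psi0_def Psi2_def T Phi_affine D_def[symmetric] by simp
    qed
    ultimately show ?thesis using in_hull[of s t Psi2] by simp
  qed
qed

section \<open>Coordinates on the family and a criterion for planar vertices\<close>

text \<open>For distinct \<open>i, j\<close>, the \<open>(j, j)\<close> entry of the image of
  \<open>E_ii\<close> is \<alpha>/d, and the \<open>(i, j)\<close> entry of the image of
  \<open>E_ij\<close> is 1 - \<alpha> - \<beta>. Reading them off gives affine functionals on all
  maps.\<close>

lemma Phi_coordinates:
  assumes "CARD('d::finite) \<ge> 2"
  obtains al be :: "'d::finite mat_map \<Rightarrow> real"
  where "\<And>\<alpha> \<beta>. al (Phi \<alpha> \<beta>) = \<alpha>" and "\<And>\<alpha> \<beta>. be (Phi \<alpha> \<beta>) = \<beta>"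
    and "\<And>x y t. al ((1 - t) *\<^sub>R x + t *\<^sub>R y) = (1 - t) * al x + t * al y"
    and "\<And>x y t. be ((1 - t) *\<^sub>R x + t *\<^sub>R y) = (1 - t) * be x + t * be y"
proof -
  obtain i j :: 'd where ij: "i \<noteq> j"
    using assms by (rule ex_distinct)
  define E :: "'d \<Rightarrow> complex^'d^'d" where "E b = (\<chi> p q. of_bool (p = i \<and> q = b))" for b
  define al :: "'d mat_map \<Rightarrow> real" where "al x = real CARD('d) * Re (blinfun_apply x (E i) $ j $ j)" for x
  define be :: "'d mat_map \<Rightarrow> real" where "be x = 1 - al x - Re (blinfun_apply x (E j) $ i $ j)" for x
  show ?thesis
  proof
    show "al (Phi \<alpha> \<beta>) = \<alpha>" for \<alpha> \<beta>
      using ij by (auto simp: al_def blinfun_apply_Phi E_def trace_def)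
    then show "be (Phi \<alpha> \<beta>) = \<beta>" for \<alpha> \<beta>
      using ij by (auto simp: be_def blinfun_apply_Phi E_def)
    show al: "al ((1 - t) *\<^sub>R x + t *\<^sub>R y) = (1 - t) * al x + t * al y" for x y t
      by (simp add: al_def blinfun.bilinear_simps algebra_simps)
    show "be ((1 - t) *\<^sub>R x + t *\<^sub>R y) = (1 - t) * be x + t * be y" for x y t
      by (simp add: be_def al blinfun.bilinear_simps) (simp add: algebra_simps)
  qed
qed

text \<open>Two supporting lines with independent normals meet at \<open>x\<close>. If
  \<open>x\<close> is inside a segment of \<open>S\<close>, both functionals vanish at its
  endpoints, which forces the endpoints to coincide with \<open>x\<close>.\<close>

lemma extreme_point_of_planar_vertex:
  fixes al be :: "'a::real_vector \<Rightarrow> real"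
  assumes "x \<in> S"
    and al: "\<And>y z t. al ((1 - t) *\<^sub>R y + t *\<^sub>R z) = (1 - t) * al y + t * al z"
    and be: "\<And>y z t. be ((1 - t) *\<^sub>R y + t *\<^sub>R z) = (1 - t) * be y + t * be z"
    and inj: "\<And>y. y \<in> S \<Longrightarrow> al y = al x \<Longrightarrow> be y = be x \<Longrightarrow> y = x"
    and pq: "\<And>y. y \<in> S \<Longrightarrow> 0 \<le> p * (al y - al x) + q * (be y - be x)"
    and pq': "\<And>y. y \<in> S \<Longrightarrow> 0 \<le> p' * (al y - al x) + q' * (be y - be x)"
    and det: "p * q' \<noteq> p' * q"
  shows "x extreme_point_of S"
  unfolding extreme_point_of_def
proof (intro conjI ballI notI)
  fix y z assume y: "y \<in> S" and z: "z \<in> S" and "x \<in> open_segment y z"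
  then obtain t where t: "0 < t" "t < 1" "x = (1 - t) *\<^sub>R y + t *\<^sub>R z" and "y \<noteq> z"
    by (auto simp: in_segment)
  have x: "al x = (1 - t) * al y + t * al z" "be x = (1 - t) * be y + t * be z"
    unfolding t(3) al be by simp_all
  have tight: "f * (al w - al x) + g * (be w - be x) = 0"
    if "\<And>y. y \<in> S \<Longrightarrow> 0 \<le> f * (al y - al x) + g * (be y - be x)" and "w \<in> {y, z}" for f g w
  proof -
    let ?L = "\<lambda>w. f * (al w - al x) + g * (be w - be x)"
    have "(1 - t) * ?L y + t * ?L z = 0"
      unfolding x by (simp add: algebra_simps)
    moreover have "0 \<le> ?L y" "0 \<le> ?L z" using that y z by auto
    ultimately have "(1 - t) * ?L y = 0 \<and> t * ?L z = 0"
      using t by (intro add_nonneg_eq_0_iff[THEN iffD1] mult_nonneg_nonneg) auto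
    then show ?thesis using t that(2) by auto
  qed
  have "w = x" if w: "w \<in> {y, z}" for w
  proof -
    let ?a = "al w - al x" and ?b = "be w - be x"
    have L: "p * ?a + q * ?b = 0" "p' * ?a + q' * ?b = 0"
      using tight[OF pq w] tight[OF pq' w] by auto
    \<comment> \<open>Cramer's rule for the two linear equations in \<open>?a\<close> and
      \<open>?b\<close>.\<close>
    have "(p * q' - p' * q) * ?a = q' * (p * ?a + q * ?b) - q * (p' * ?a + q' * ?b)"
      "(p * q' - p' * q) * ?b = p * (p' * ?a + q' * ?b) - p' * (p * ?a + q * ?b)"
      by (simp_all add: algebra_simps)
    then have "?a = 0" "?b = 0" using L det by auto
    then show ?thesis using inj w y z by auto
  qed
  then show False using \<open>y \<noteq> z\<close> by auto
qed (rule assms(1))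

section \<open>Assembling the hull and checking that its corners are non-degenerate\<close>

theorem proposition2p8:
  assumes "CARD('d::finite) \<ge> 3"
    and "CARD('k::finite) = CARD('d) - 1"
  shows "quadrilateral {\<Phi> :: 'd mat_map. \<exists>\<alpha> \<beta>. \<Phi> = Phi \<alpha> \<beta> \<and> k_positive TYPE('k) \<Phi>} \<and>
         {\<Phi> :: 'd mat_map. \<exists>\<alpha> \<beta>. \<Phi> = Phi \<alpha> \<beta> \<and> k_positive TYPE('k) \<Phi>}
           = convex hull {Psi0, Psi1, Psi2, T_map CARD('k)}"
proof -
  define D where "D = real CARD('d)"
  have D: "D \<ge> 3" using assms(1) by (simp add: D_def)
  define N where "N = (D - 1) * D - 1"
  have N: "N > 0" using mult_mono[of 2 "D - 1" 3 D] D by (simp add: N_def)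
  have k: "real CARD('k) = D - 1" using assms by (simp add: D_def)
  have T: "T_map CARD('k) = (Phi ((D - 1) * D / N) 0 :: 'd mat_map)"
    by (simp add: T_map_def k N_def flip: D_def)
  note vertex_defs = Psi0_def Psi1_def Psi2_def T D_def[symmetric]
  define S where "S = {\<Phi> :: 'd mat_map. \<exists>\<alpha> \<beta>. \<Phi> = Phi \<alpha> \<beta> \<and> k_positive TYPE('k) \<Phi>}"
  define V where "V = {Psi0, Psi1, Psi2, T_map CARD('k) :: 'd mat_map}"
  have ineqs: "0 \<le> \<alpha>" "0 \<le> \<alpha> / D + \<beta>"
      "0 \<le> (D - 1) * (1 - \<alpha> - \<beta>) + \<alpha> / D + \<beta>"
      "0 \<le> (D - 1) * (1 - \<alpha> - \<beta>) + \<alpha> / D + \<beta> * ((D - 1) / D)"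
    if "Phi \<alpha> \<beta> \<in> S" for \<alpha> \<beta>
  proof -
    have pos: "k_positive TYPE('k) (Phi \<alpha> \<beta> :: 'd mat_map)" using that by (simp add: S_def)
    show "0 \<le> \<alpha>" "0 \<le> \<alpha> / D + \<beta>"
      "0 \<le> (D - 1) * (1 - \<alpha> - \<beta>) + \<alpha> / D + \<beta>"
      "0 \<le> (D - 1) * (1 - \<alpha> - \<beta>) + \<alpha> / D + \<beta> * ((D - 1) / D)"
      using k_positive_Phi_imp_ge_0[OF pos] k_positive_Phi_imp_diag_ge_0[OF pos]
        k_positive_Phi_imp_trace_ge_0[OF pos] k_positive_Phi_imp_centering_ge_0[OF pos] assms
      by (simp_all add: D_def)
  qed
  have S_Phi: "\<exists>\<alpha> \<beta>. y = Phi \<alpha> \<beta>" if "y \<in> S" for y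
    using that by (auto simp: S_def)
  have VS: "V \<subseteq> S"
    using assms k_positive_Psi0[where 'd = 'd and 'k = 'k]
      k_positive_Psi1[where 'd = 'd and 'k = 'k] k_positive_Psi2[where 'd = 'd and 'k = 'k]
      k_positive_T_map[OF assms]
    by (auto simp: V_def S_def) (auto simp: Psi0_def Psi1_def Psi2_def T_map_def)
  have S_eq: "S = convex hull V"
  proof
    show "S \<subseteq> convex hull V"
    proof
      fix y assume y: "y \<in> S"
      then obtain \<alpha> \<beta> where "y = Phi \<alpha> \<beta>" using S_Phi by blast
      then show "y \<in> convex hull V"
        unfolding V_def using ineqs[of \<alpha> \<beta>] y Phi_in_convex_hull[OF assms, of \<alpha> \<beta>]
        by (simp add: D_def)
    qed
    have "S = {\<Phi>. \<exists>\<alpha> \<beta>. \<Phi> = Phi \<alpha> \<beta>} \<inter> {\<Phi>. k_positive TYPE('k) \<Phi>}"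
      by (auto simp: S_def)
    then have "convex S"
      by (simp add: convex_Int convex_range_Phi convex_k_positive)
    then show "convex hull V \<subseteq> S" using VS by (simp add: hull_minimal)
  qed
  have d2: "CARD('d) \<ge> 2" using assms(1) by simp
  obtain al be :: "'d mat_map \<Rightarrow> real"
    where al: "\<And>\<alpha> \<beta>. al (Phi \<alpha> \<beta>) = \<alpha>" and be: "\<And>\<alpha> \<beta>. be (Phi \<alpha> \<beta>) = \<beta>"
    and affine: "\<And>x y t. al ((1 - t) *\<^sub>R x + t *\<^sub>R y) = (1 - t) * al x + t * al y"
      "\<And>x y t. be ((1 - t) *\<^sub>R x + t *\<^sub>R y) = (1 - t) * be x + t * be y"
    using Phi_coordinates[OF d2] by blast
  have Phi_inj: "Phi \<alpha> \<beta> = (Phi \<alpha>' \<beta>' :: 'd mat_map) \<longleftrightarrow> \<alpha> = \<alpha>' \<and> \<beta> = \<beta>'" for \<alpha> \<beta> \<alpha>' \<beta>'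
    by (metis al be)
  \<comment> \<open>The vertex criterion in parameters: \<open>(p, q, r)\<close> and
    \<open>(p', q', r')\<close> are the two edge lines through \<open>(a, b)\<close>.\<close>
  have extreme: "Phi a b extreme_point_of S"
    if "Phi a b \<in> S" and det: "p * q' \<noteq> p' * q" and r: "p * a + q * b = r" and r': "p' * a + q' * b = r'"
      and le: "\<And>\<alpha> \<beta>. Phi \<alpha> \<beta> \<in> S \<Longrightarrow> r \<le> p * \<alpha> + q * \<beta>"
      and le': "\<And>\<alpha> \<beta>. Phi \<alpha> \<beta> \<in> S \<Longrightarrow> r' \<le> p' * \<alpha> + q' * \<beta>"
    for a b p q p' q' r r'
  proof (rule extreme_point_of_planar_vertex[OF that(1) affine _ _ _ det])
    fix y assume y: "y \<in> S"
    then obtain \<alpha> \<beta> where y': "y = Phi \<alpha> \<beta>" using S_Phi by blast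
    show "0 \<le> p * (al y - al (Phi a b)) + q * (be y - be (Phi a b))"
      using le[of \<alpha> \<beta>] y r by (simp add: y' al be right_diff_distrib)
    show "0 \<le> p' * (al y - al (Phi a b)) + q' * (be y - be (Phi a b))"
      using le'[of \<alpha> \<beta>] y r' by (simp add: y' al be right_diff_distrib)
    show "y = Phi a b" if "al y = al (Phi a b)" "be y = be (Phi a b)"
      using that by (simp add: y' al be)
  qed
  have trace: "- (D - 1) \<le> (1 / D - (D - 1)) * \<alpha> + (1 - (D - 1)) * \<beta>" if "Phi \<alpha> \<beta> \<in> S" for \<alpha> \<beta>
    using ineqs(3)[OF that] by (simp add: algebra_simps)
  have centering: "- (D - 1) \<le> (1 / D - (D - 1)) * \<alpha> + ((D - 1) / D - (D - 1)) * \<beta>"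
    if "Phi \<alpha> \<beta> \<in> S" for \<alpha> \<beta>
    using ineqs(4)[OF that] by (simp add: algebra_simps)
  have pN: "1 / D - (D - 1) = - N / D"
    using D by (simp add: N_def field_simps)
  have qN: "(D - 1) / D - (D - 1) = - (D - 1)\<^sup>2 / D"
    using D by (simp add: field_simps power2_eq_square)
  \<comment> \<open>Each corner lies on two edges: \<open>Psi0\<close> on \<alpha> = 0 and
    \<alpha>/D + \<beta> = 0, \<open>Psi1\<close> on \<alpha> = 0 and the \<open>centering\<close>
    line, \<open>Psi2\<close> on \<alpha>/D + \<beta> = 0 and the \<open>trace\<close> line,
    \<open>T_map\<close> on the last two.\<close>
  have "Psi0 extreme_point_of S"
    unfolding vertex_defs
  proof (rule extreme[where p = 1 and q = 0 and p' = "1 / D" and q' = 1])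
    show "Phi 0 0 \<in> S" using VS by (simp add: V_def Psi0_def)
  qed (use ineqs in auto)
  moreover have "Psi1 extreme_point_of S"
    unfolding vertex_defs
  proof (rule extreme[OF _ _ _ _ _ centering, where p = 1 and q = 0])
    show "Phi 0 (D / (D - 1)) \<in> S" using VS by (simp add: V_def Psi1_def D_def)
    show "(1 / D - (D - 1)) * 0 + ((D - 1) / D - (D - 1)) * (D / (D - 1)) = - (D - 1)"
      unfolding qN using D by (simp add: power2_eq_square)
    show "1 * ((D - 1) / D - (D - 1)) \<noteq> (1 / D - (D - 1)) * 0"
      unfolding qN using D by simp
  qed (use ineqs in auto)
  moreover have "Psi2 extreme_point_of S"
    unfolding vertex_defs
  proof (rule extreme[OF _ _ _ _ _ trace, where p = "1 / D" and q = 1])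
    show "Phi (D / (D - 1)) (- 1 / (D - 1)) \<in> S" using VS by (simp add: V_def Psi2_def D_def)
    show "1 / D * (1 - (D - 1)) \<noteq> (1 / D - (D - 1)) * 1"
    proof -
      have "(1 / D - (D - 1)) * 1 - 1 / D * (1 - (D - 1)) = - (D - 1)\<^sup>2 / D"
        using D by (simp add: field_simps power2_eq_square)
      moreover have "- (D - 1)\<^sup>2 / D \<noteq> 0" using D by simp
      ultimately show ?thesis by linarith
    qed
    show "1 / D * (D / (D - 1)) + 1 * (- 1 / (D - 1)) = 0"
      using D by simp
    have "- N / D * (D / (D - 1)) = - N / (D - 1)" using D by simp
    moreover have "- N / (D - 1) + (1 - (D - 1)) * (- 1 / (D - 1)) = - (D - 1)"
      using D by (simp add: N_def divide_simps) (simp add: algebra_simps)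
    ultimately show "(1 / D - (D - 1)) * (D / (D - 1)) + (1 - (D - 1)) * (- 1 / (D - 1)) = - (D - 1)"
      unfolding pN using D by simp
    show "0 \<le> 1 / D * \<alpha> + 1 * \<beta>" if "Phi \<alpha> \<beta> \<in> S" for \<alpha> \<beta>
      using ineqs(2)[OF that] by simp
  qed
  moreover have "T_map CARD('k) extreme_point_of S"
    unfolding vertex_defs
  proof (rule extreme[OF _ _ _ _ trace centering])
    show "Phi ((D - 1) * D / N) 0 \<in> S" using VS by (simp add: V_def T)
    show "(1 / D - (D - 1)) * ((D - 1) / D - (D - 1)) \<noteq> (1 / D - (D - 1)) * (1 - (D - 1))"
      unfolding pN using D N by simp
    have "(1 / D - (D - 1)) * ((D - 1) * D / N) = - (D - 1)"
      unfolding pN using D N by simp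
    then show "(1 / D - (D - 1)) * ((D - 1) * D / N) + (1 - (D - 1)) * 0 = - (D - 1)"
      "(1 / D - (D - 1)) * ((D - 1) * D / N) + ((D - 1) / D - (D - 1)) * 0 = - (D - 1)"
      by simp_all
  qed
  ultimately have "\<forall>v\<in>V. v extreme_point_of S" by (simp add: V_def)
  moreover have "card V = 4"
  proof -
    \<comment> \<open>The four parameter pairs differ in which of their coordinates are
      zero.\<close>
    have "D / (D - 1) \<noteq> 0" "- 1 / (D - 1) \<noteq> 0" "(D - 1) * D / N \<noteq> 0"
      using D N by auto
    then show ?thesis by (simp add: V_def vertex_defs Phi_inj)
  qed
  moreover have "coplanar V"
  proof -
    \<comment> \<open>The images of (0, 0), (1, 0) and (0, 1) span the plane of the family, with
      weights 1 - \<alpha> - \<beta>, \<alpha> and \<beta>.\<close>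
    have "y \<in> affine hull {Phi 0 0, Phi 1 0, Phi 0 1}" if y: "y \<in> V" for y :: "'d mat_map"
    proof -
      obtain \<alpha> \<beta> where "y = Phi \<alpha> \<beta>" using S_Phi[OF subsetD[OF VS y]] by blast
      then have "y = (1 - \<alpha> - \<beta>) *\<^sub>R Phi 0 0 + \<alpha> *\<^sub>R Phi 1 0 + \<beta> *\<^sub>R Phi 0 1"
        by (simp add: Phi_affine)
      then show ?thesis
        unfolding affine_hull_3 by (intro CollectI exI conjI) auto
    qed
    then show ?thesis
      unfolding coplanar_def by (intro exI subsetI)
  qed
  ultimately have "quadrilateral S"
    unfolding quadrilateral_def using S_eq by (intro exI[of _ V] conjI) auto
  then show ?thesis using S_eq by (simp add: S_def V_def)
qed

end
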